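(* Let $(X,\varphi)$ be an irreducible topological Markov chain and $Q$ a periodic orbit, with stable groupoid $G^s(Q)$. Then there is a family of compatible ultrametrics $\{D_{s,\kappa}:\kappa>1\}$ on $G^s(Q)$ such that, with respect to each of these ultrametrics, (1) the inverse $\Phi^{-1}:G^s(Q)\to G^s(Q)$ of the groupoid automorphism $\Phi=\varphi\times\varphi$ is bi-Lipschitz with $$\kappa^{-1}D_{s,\kappa}(a,b)\le D_{s,\kappa}(\Phi^{-1}(a),\Phi^{-1}(b))\le D_{s,\kappa}(a,b)$$ for every $a,b\in G^s(Q)$; (2) the map $\Phi^{-1}$ is locally contracting: if $D_{s,\kappa}(a,b)\le\kappa^{-1}$, then $$D_{s,\kappa}(\Phi^{-1}(a),\Phi^{-1}(b))=\kappa^{-1}D_{s,\kappa}(a,b);$$ (3) the range and source maps onto $(X^u(Q),\widetilde{D_{s,\kappa}})$ are locally isometric. Moreover, the inversion map $(x,y)\mapsto(y,x)$ is isometric.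
   Context: For an $N\times N$ matrix $M$ with entries in $\{0,1\}$, let $X=\{x\in\{1,\dots,N\}^{\mathbb Z}:M_{x_i,x_{i+1}}=1\ \forall i\}$ with the product topology and let $\varphi$ be the shift $\varphi(x)_i=x_{i+1}$; $(X,\varphi)$ is a topological Markov chain, with $X$ assumed infinite. Its topology is induced by each ultrametric $d_\kappa(x,y)=\inf\{\kappa^{-n}:n\ge0,\ x_i=y_i\text{ for }|i|<n\}$, $\kappa>1$. It is irreducible if for all non-empty open $U,V\subset X$ there is $n\in\mathbb N$ with $\varphi^n(U)\cap V\neq\varnothing$. The global stable and unstable sets are $X^s(x)=\{y:\exists m\ \forall i\ge m,\ y_i=x_i\}$ and $X^u(x)=\{y:\exists m\ \forall i\le m,\ y_i=x_i\}$; $X^u(Q)=\bigcup_{q\in Q}X^u(q)$. The stable groupoid is $G^s(Q)=\{(v,w):v,w\in X^u(Q),\ w\in X^s(v)\}$ with equivalence-relation groupoid structure, range $r(x,y)=x$ and source $s(x,y)=y$. It has the second countable, locally compact, Hausdorff étale topology with base the sets $$\{b\in G^s(Q):(b_j)_i=(a_j)_i\text{ for }i\le n,\ j=1,2;\ (b_1)_i=(b_2)_i\text{ for }i>n\},$$ where $a=(a_1,a_2)\in G^s(Q)$ and $n\ge0$ is such that $(a_1)_i=(a_2)_i$ for all $i\ge n$. An ultrametric is compatible if it induces this topology. $\widetilde{D_{s,\kappa}}(x,y)=D_{s,\kappa}((x,x),(y,y))$ for $x,y\in X^u(Q)$. A map is locally isometric if every point has a neighbourhood on which the map preserves distances. 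*)

theory Defs
  imports "HOL-Analysis.Analysis"
begin

section \<open>Topological Markov chains\<close>

text \<open>The matrix of size \<open>N\<close> is a function on indices, of which only the values at
  \<open>i, j \<in> {1..N}\<close> matter.\<close>

definition zero_one_matrix :: "nat \<Rightarrow> (nat \<Rightarrow> nat \<Rightarrow> nat) \<Rightarrow> bool" where
  "zero_one_matrix N M \<longleftrightarrow> (\<forall>i\<in>{1..N}. \<forall>j\<in>{1..N}. M i j \<in> {0, 1})"

definition chain_space :: "nat \<Rightarrow> (nat \<Rightarrow> nat \<Rightarrow> nat) \<Rightarrow> (int \<Rightarrow> nat) set" where
  "chain_space N M = {x. (\<forall>i. x i \<in> {1..N}) \<and> (\<forall>i. M (x i) (x (i + 1)) = 1)}"

definition chain_topology :: "nat \<Rightarrow> (nat \<Rightarrow> nat \<Rightarrow> nat) \<Rightarrow> (int \<Rightarrow> nat) topology" where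
  "chain_topology N M =
     subtopology (product_topology (\<lambda>_. discrete_topology {1..N}) UNIV) (chain_space N M)"

definition shift :: "(int \<Rightarrow> nat) \<Rightarrow> int \<Rightarrow> nat" where
  "shift x = (\<lambda>i. x (i + 1))"

definition irreducible_chain :: "nat \<Rightarrow> (nat \<Rightarrow> nat \<Rightarrow> nat) \<Rightarrow> bool" where
  "irreducible_chain N M \<longleftrightarrow>
     (\<forall>U V. openin (chain_topology N M) U \<and> U \<noteq> {} \<and> openin (chain_topology N M) V \<and> V \<noteq> {}
        \<longrightarrow> (\<exists>n::nat. (shift ^^ n) ` U \<inter> V \<noteq> {}))"

definition periodic_orbit :: "nat \<Rightarrow> (nat \<Rightarrow> nat \<Rightarrow> nat) \<Rightarrow> (int \<Rightarrow> nat) set \<Rightarrow> bool" where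
  "periodic_orbit N M Q \<longleftrightarrow>
     (\<exists>p\<in>chain_space N M. (\<exists>k>0. (shift ^^ k) p = p) \<and> Q = range (\<lambda>n. (shift ^^ n) p))"


section \<open>The stable groupoid\<close>

definition stable_set :: "nat \<Rightarrow> (nat \<Rightarrow> nat \<Rightarrow> nat) \<Rightarrow> (int \<Rightarrow> nat) \<Rightarrow> (int \<Rightarrow> nat) set" where
  "stable_set N M x = {y \<in> chain_space N M. \<exists>m. \<forall>i\<ge>m. y i = x i}"

definition unstable_set :: "nat \<Rightarrow> (nat \<Rightarrow> nat \<Rightarrow> nat) \<Rightarrow> (int \<Rightarrow> nat) \<Rightarrow> (int \<Rightarrow> nat) set" where
  "unstable_set N M x = {y \<in> chain_space N M. \<exists>m. \<forall>i\<le>m. y i = x i}"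

definition unstable_sets :: "nat \<Rightarrow> (nat \<Rightarrow> nat \<Rightarrow> nat) \<Rightarrow> (int \<Rightarrow> nat) set \<Rightarrow> (int \<Rightarrow> nat) set" where
  "unstable_sets N M Q = (\<Union>q\<in>Q. unstable_set N M q)"

definition stable_groupoid ::
    "nat \<Rightarrow> (nat \<Rightarrow> nat \<Rightarrow> nat) \<Rightarrow> (int \<Rightarrow> nat) set \<Rightarrow> ((int \<Rightarrow> nat) \<times> (int \<Rightarrow> nat)) set" where
  "stable_groupoid N M Q =
     {(v, w). v \<in> unstable_sets N M Q \<and> w \<in> unstable_sets N M Q \<and> w \<in> stable_set N M v}"

definition stable_basic ::
    "nat \<Rightarrow> (nat \<Rightarrow> nat \<Rightarrow> nat) \<Rightarrow> (int \<Rightarrow> nat) set \<Rightarrow>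
     (int \<Rightarrow> nat) \<times> (int \<Rightarrow> nat) \<Rightarrow> nat \<Rightarrow> ((int \<Rightarrow> nat) \<times> (int \<Rightarrow> nat)) set" where
  "stable_basic N M Q a n =
     {b \<in> stable_groupoid N M Q.
        (\<forall>i \<le> int n. fst b i = fst a i \<and> snd b i = snd a i) \<and>
        (\<forall>i > int n. fst b i = snd b i)}"

definition stable_base ::
    "nat \<Rightarrow> (nat \<Rightarrow> nat \<Rightarrow> nat) \<Rightarrow> (int \<Rightarrow> nat) set \<Rightarrow>
     ((int \<Rightarrow> nat) \<times> (int \<Rightarrow> nat)) set set" where
  "stable_base N M Q =
     {stable_basic N M Q a n | a n.
        a \<in> stable_groupoid N M Q \<and> (\<forall>i \<ge> int n. fst a i = snd a i)}"

text \<open>The generating family really is a base, see \<open>openin_stable_topology\<close> below.\<close>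

definition stable_topology ::
    "nat \<Rightarrow> (nat \<Rightarrow> nat \<Rightarrow> nat) \<Rightarrow> (int \<Rightarrow> nat) set \<Rightarrow>
     ((int \<Rightarrow> nat) \<times> (int \<Rightarrow> nat)) topology" where
  "stable_topology N M Q = topology_generated_by (stable_base N M Q)"

lemma stable_baseI:
  assumes "a \<in> stable_groupoid N M Q" "\<forall>i \<ge> int n. fst a i = snd a i"
  shows "stable_basic N M Q a n \<in> stable_base N M Q" "a \<in> stable_basic N M Q a n"
  using assms unfolding stable_base_def by (blast, simp add: stable_basic_def)

lemma Union_stable_base: "\<Union> (stable_base N M Q) = stable_groupoid N M Q"
proof
  show "\<Union> (stable_base N M Q) \<subseteq> stable_groupoid N M Q"
    by (auto simp: stable_base_def stable_basic_def)
  show "stable_groupoid N M Q \<subseteq> \<Union> (stable_base N M Q)"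
  proof
    fix a assume a: "a \<in> stable_groupoid N M Q"
    then obtain m where m: "\<forall>i\<ge>m. snd a i = fst a i"
      by (auto simp: stable_groupoid_def stable_set_def)
    then have "\<forall>i \<ge> int (nat m). fst a i = snd a i" by auto
    then have "stable_basic N M Q a (nat m) \<in> stable_base N M Q"
      and "a \<in> stable_basic N M Q a (nat m)"
      using a by (simp_all only: stable_baseI)
    then show "a \<in> \<Union> (stable_base N M Q)" by blast
  qed
qed

lemma topspace_stable_topology [simp]:
  "topspace (stable_topology N M Q) = stable_groupoid N M Q"
  by (simp add: stable_topology_def Union_stable_base)

lemma stable_base_Int:
  assumes "A \<in> stable_base N M Q" "B \<in> stable_base N M Q" "b \<in> A \<inter> B"
  shows "\<exists>C\<in>stable_base N M Q. b \<in> C \<and> C \<subseteq> A \<inter> B"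
proof -
  obtain a n where A: "A = stable_basic N M Q a n" and a: "\<forall>i \<ge> int n. fst a i = snd a i"
    using assms(1) by (auto simp: stable_base_def)
  obtain a' n' where B: "B = stable_basic N M Q a' n'" and a': "\<forall>i \<ge> int n'. fst a' i = snd a' i"
    using assms(2) by (auto simp: stable_base_def)
  define m where "m = max n n'"
  have b: "b \<in> stable_groupoid N M Q"
    and bA: "\<And>i. i \<le> int n \<Longrightarrow> fst b i = fst a i \<and> snd b i = snd a i"
    and bB: "\<And>i. i \<le> int n' \<Longrightarrow> fst b i = fst a' i \<and> snd b i = snd a' i"
    and bn: "\<And>i. i > int n \<Longrightarrow> fst b i = snd b i" "\<And>i. i > int n' \<Longrightarrow> fst b i = snd b i"
    using assms(3) unfolding A B stable_basic_def by auto
  have bm: "\<forall>i \<ge> int m. fst b i = snd b i"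
    by (metis a a' bA bB bn linorder_not_less m_def max_def order_le_less)
  have "stable_basic N M Q b m \<subseteq> A \<inter> B"
  proof
    fix c assume c: "c \<in> stable_basic N M Q b m"
    then have cG: "c \<in> stable_groupoid N M Q"
      and cb: "\<And>i. i \<le> int m \<Longrightarrow> fst c i = fst b i \<and> snd c i = snd b i"
      and cm: "\<And>i. i > int m \<Longrightarrow> fst c i = snd c i"
      unfolding stable_basic_def by auto
    have le: "int n \<le> int m" "int n' \<le> int m" by (auto simp: m_def)
    have "fst c i = snd c i" if "i > int n \<or> i > int n'" for i
      using that cb cm bn by (cases "i \<le> int m") auto
    then show "c \<in> A \<inter> B"
      unfolding A B stable_basic_def using cG cb bA bB le by auto
  qed
  moreover have "stable_basic N M Q b m \<in> stable_base N M Q" "b \<in> stable_basic N M Q b m"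
    using b bm by (simp_all only: stable_baseI)
  ultimately show ?thesis by blast
qed

lemma openin_stable_topology:
  "openin (stable_topology N M Q) = arbitrary union_of (\<lambda>U. U \<in> stable_base N M Q)"
proof -
  let ?P = "\<lambda>U. U \<in> stable_base N M Q"
  have ist: "istopology (arbitrary union_of ?P)"
    unfolding istopology_base_eq
  proof (intro allI impI, elim conjE)
    fix S T assume "?P S" "?P T"
    then show "(arbitrary union_of ?P) (S \<inter> T)"
      unfolding arbitrary_union_of_alt using stable_base_Int by meson
  qed
  have base: "(arbitrary union_of ?P) U" if "?P U" for U
    using that by (simp add: union_of_inc arbitrary_def)
  show ?thesis
  proof (intro ext iffI)
    fix U assume "openin (stable_topology N M Q) U"
    then have "generate_topology_on (stable_base N M Q) U"
      by (simp add: stable_topology_def openin_topology_generated_by_iff)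
    then show "(arbitrary union_of ?P) U"
    proof (rule generate_topology_on_coarsest[OF ist, rotated])
      show "\<And>s. s \<in> stable_base N M Q \<Longrightarrow> (arbitrary union_of ?P) s" by (rule base)
    qed
  next
    fix U assume "(arbitrary union_of ?P) U"
    then show "openin (stable_topology N M Q) U"
      unfolding stable_topology_def union_of_def
      by (metis mem_Collect_eq openin_Union subset_iff topology_generated_by_Basis)
  qed
qed

definition Phi ::
    "(int \<Rightarrow> nat) \<times> (int \<Rightarrow> nat) \<Rightarrow> (int \<Rightarrow> nat) \<times> (int \<Rightarrow> nat)" where
  "Phi = map_prod shift shift"

text \<open>In the groupoid of an equivalence relation, \<open>fst\<close> is the range map, \<open>snd\<close> the source map
  and \<open>prod.swap\<close> the inversion; \<open>a\<close> and \<open>b\<close> are composable iff \<open>snd a = fst b\<close>, with product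
  \<open>(fst a, snd b)\<close>. Automorphisms are taken in the category of topological groupoids.\<close>

definition groupoid_automorphism :: "('a \<times> 'a) topology \<Rightarrow> ('a \<times> 'a \<Rightarrow> 'a \<times> 'a) \<Rightarrow> bool" where
  "groupoid_automorphism G F \<longleftrightarrow>
     homeomorphic_map G G F \<and>
     (\<forall>a\<in>topspace G. \<forall>b\<in>topspace G. snd a = fst b \<longrightarrow>
        snd (F a) = fst (F b) \<and> F (fst a, snd b) = (fst (F a), snd (F b)))"


section \<open>Ultrametrics\<close>

definition ultrametric_on :: "'a set \<Rightarrow> ('a \<Rightarrow> 'a \<Rightarrow> real) \<Rightarrow> bool" where
  "ultrametric_on S d \<longleftrightarrow>
     Metric_space S d \<and> (\<forall>x\<in>S. \<forall>y\<in>S. \<forall>z\<in>S. d x z \<le> max (d x y) (d y z))"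

definition compatible_ultrametric :: "'a topology \<Rightarrow> ('a \<Rightarrow> 'a \<Rightarrow> real) \<Rightarrow> bool" where
  "compatible_ultrametric T d \<longleftrightarrow>
     ultrametric_on (topspace T) d \<and> Metric_space.mtopology (topspace T) d = T"

definition locally_isometric ::
    "'a topology \<Rightarrow> ('a \<Rightarrow> 'a \<Rightarrow> real) \<Rightarrow> ('b \<Rightarrow> 'b \<Rightarrow> real) \<Rightarrow> ('a \<Rightarrow> 'b) \<Rightarrow> bool" where
  "locally_isometric T d d' f \<longleftrightarrow>
     (\<forall>a\<in>topspace T. \<exists>U. openin T U \<and> a \<in> U \<and> (\<forall>b\<in>U. \<forall>c\<in>U. d' (f b) (f c) = d b c))"

definition unit_metric :: "('a \<times> 'a \<Rightarrow> 'a \<times> 'a \<Rightarrow> real) \<Rightarrow> 'a \<Rightarrow> 'a \<Rightarrow> real" where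
  "unit_metric D x y = D (x, x) (y, y)"

end

theory Submission imports Defs begin

text \<open>
  A basic open set of the stable groupoid consists of pairs that are prescribed up to a level
  \<open>n\<close> and whose two components coincide above \<open>n\<close>. So any two elements \<open>a\<close> and \<open>b\<close> of it agree up
  to \<open>n\<close>, and each of them has equal components above \<open>n\<close>; this symmetric relation between \<open>a\<close>
  and \<open>b\<close> is \<open>cylinder_eq n a b\<close>. For \<open>a \<noteq> b\<close> it holds at only finitely
  many levels, and \<open>depth a b\<close> is the greatest of them, or \<open>0\<close> if there is none. The ultrametric is
  \<open>\<kappa>\<^sup>-\<^sup>d\<close> with \<open>d = depth a b\<close>.

  The relation is not monotone in \<open>n\<close>: agreement gets rarer as \<open>n\<close> grows, but equality of the
  components above \<open>n\<close> gets more common. What makes the proof work is the relation \<open>near n\<close>,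
  that \<open>cylinder_eq\<close> holds at some level \<open>\<ge> n\<close>. It decreases with \<open>n\<close>, and it is transitive, because
  agreement with an element whose components coincide above a lower level carries this property
  over (\<open>cylinder_eq_trans\<close>). Transitivity is the ultrametric inequality, and around each point the
  relations \<open>near n\<close> describe the given topology (\<open>openin_stable_topology_iff_near\<close>).

  Applying \<open>\<Phi>\<close> lowers all levels by exactly one and loses level \<open>0\<close> (\<open>cylinder_eq_Phi\<close>). So it
  lowers the depth by one, except that depth \<open>0\<close> stays \<open>0\<close>; this truncation is the difference between (1) and (2). Inside a basic set of
  level \<open>n\<close> the second component of an element is determined by the first, and from level \<open>n\<close> on
  \<open>cylinder_eq\<close> only compares first components; so the range map is isometric there. The source map is
  the range map after the inversion, and the inversion is visibly an isometry.
\<close>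

section \<open>Levels of coincidence\<close>

definition cylinder_eq ::
    "nat \<Rightarrow> (int \<Rightarrow> nat) \<times> (int \<Rightarrow> nat) \<Rightarrow> (int \<Rightarrow> nat) \<times> (int \<Rightarrow> nat) \<Rightarrow> bool" where
  "cylinder_eq n a b \<longleftrightarrow>
     (\<forall>i \<le> int n. fst a i = fst b i \<and> snd a i = snd b i) \<and>
     (\<forall>i > int n. fst a i = snd a i \<and> fst b i = snd b i)"

definition near ::
    "nat \<Rightarrow> (int \<Rightarrow> nat) \<times> (int \<Rightarrow> nat) \<Rightarrow> (int \<Rightarrow> nat) \<times> (int \<Rightarrow> nat) \<Rightarrow> bool" where
  "near n a b \<longleftrightarrow> (\<exists>m\<ge>n. cylinder_eq m a b)"

text \<open>The supremum of the empty set of natural numbers is \<open>0\<close>, the depth wanted for two elements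
  without any level of coincidence.\<close>

definition depth :: "(int \<Rightarrow> nat) \<times> (int \<Rightarrow> nat) \<Rightarrow> (int \<Rightarrow> nat) \<times> (int \<Rightarrow> nat) \<Rightarrow> nat" where
  "depth a b = Sup {n. cylinder_eq n a b}"

lemma cylinder_eq_sym: "cylinder_eq n a b \<longleftrightarrow> cylinder_eq n b a"
  by (auto simp: cylinder_eq_def)

lemma cylinder_eq_swap: "cylinder_eq n (prod.swap a) (prod.swap b) \<longleftrightarrow> cylinder_eq n a b"
  by (auto simp: cylinder_eq_def)

lemma depth_sym: "depth a b = depth b a"
  by (simp add: depth_def cylinder_eq_sym)

lemma depth_swap: "depth (prod.swap a) (prod.swap b) = depth a b"
  by (simp add: depth_def cylinder_eq_swap)

text \<open>For \<open>m \<le> n\<close>, the components of \<open>c\<close> coincide between the levels \<open>m\<close> and \<open>n\<close> because \<open>c\<close>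
  agrees there with \<open>b\<close>, so the smaller level serves for both \<open>a\<close> and \<open>c\<close>. The other case is
  symmetric.\<close>

lemma cylinder_eq_trans:
  assumes "cylinder_eq m a b" "cylinder_eq n b c"
  shows "cylinder_eq (min m n) a c"
proof (cases "m \<le> n")
  case True
  then have "int m \<le> int n" by simp
  have "fst c i = snd c i" if "i > int m" for i
    using assms that unfolding cylinder_eq_def by (cases "i \<le> int n") auto
  with True \<open>int m \<le> int n\<close> show ?thesis
    using assms unfolding cylinder_eq_def by (simp add: min_def)
next
  case False
  then have "int n \<le> int m" by simp
  have "fst a i = snd a i" if "i > int n" for i
    using assms that unfolding cylinder_eq_def by (cases "i \<le> int m") auto
  with False \<open>int n \<le> int m\<close> show ?thesis
    using assms unfolding cylinder_eq_def by (simp add: min_def)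
qed

lemma near_trans:
  assumes "near n a b" "near n b c"
  shows "near n a c"
  using assms cylinder_eq_trans unfolding near_def by (meson min.boundedI)

lemma near_mono: "near n a b \<Longrightarrow> m \<le> n \<Longrightarrow> near m a b"
  unfolding near_def using order_trans by blast

text \<open>A coordinate at which \<open>a\<close> and \<open>b\<close> differ bounds the levels of coincidence.\<close>

lemma finite_cylinder_eq:
  assumes "a \<noteq> b"
  shows "finite {n. cylinder_eq n a b}"
proof -
  obtain i where i: "fst a i \<noteq> fst b i \<or> snd a i \<noteq> snd b i"
    using assms by (metis ext prod_eq_iff)
  have "n \<le> nat i" if "cylinder_eq n a b" for n
    using that i unfolding cylinder_eq_def by (metis linear nat_int nat_mono)
  then show ?thesis
    by (intro finite_subset[OF _ finite_atMost[of "nat i"]]) auto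
qed

text \<open>Level \<open>0\<close> is excluded: depth \<open>0\<close> does not imply a coincidence at any level.\<close>

lemma le_depth_iff_near:
  assumes "a \<noteq> b" "0 < n"
  shows "n \<le> depth a b \<longleftrightarrow> near n a b"
proof (cases "{m. cylinder_eq m a b} = {}")
  case True
  then show ?thesis
    using assms by (auto simp: depth_def near_def Sup_nat_def)
next
  case False
  then show ?thesis
    using finite_cylinder_eq[OF assms(1)]
    by (auto simp: depth_def near_def Sup_nat_def Max_ge_iff)
qed

lemma depth_eqI:
  assumes "a \<noteq> b" "c \<noteq> d" "\<And>n. near n a b \<longleftrightarrow> near n c d"
  shows "depth a b = depth c d"
proof -
  have "n \<le> depth a b \<longleftrightarrow> n \<le> depth c d" for n
    using assms by (cases "n = 0") (simp_all add: le_depth_iff_near)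
  then show ?thesis
    by (meson le_antisym order_refl)
qed


section \<open>The ultrametrics\<close>

definition depth_dist ::
    "real \<Rightarrow> (int \<Rightarrow> nat) \<times> (int \<Rightarrow> nat) \<Rightarrow> (int \<Rightarrow> nat) \<times> (int \<Rightarrow> nat) \<Rightarrow> real" where
  "depth_dist \<kappa> a b = (if a = b then 0 else inverse \<kappa> ^ depth a b)"

lemma inverse_power_le_iff:
  fixes \<kappa> :: real
  assumes "1 < \<kappa>"
  shows "inverse \<kappa> ^ m \<le> inverse \<kappa> ^ n \<longleftrightarrow> n \<le> m"
  using assms by (simp add: power_decreasing_iff inverse_less_1_iff)

lemma depth_dist_ultra:
  assumes "1 < \<kappa>"
  shows "depth_dist \<kappa> a c \<le> max (depth_dist \<kappa> a b) (depth_dist \<kappa> b c)"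
proof (cases "a = c \<or> a = b \<or> b = c")
  case True
  then show ?thesis
    using assms by (auto simp: depth_dist_def le_max_iff_disj)
next
  case False
  let ?n = "min (depth a b) (depth b c)"
  have "?n \<le> depth a c"
  proof (cases "?n = 0")
    case True
    then show ?thesis by linarith
  next
    case nz: False
    then have "near ?n a b" "near ?n b c"
      using False by (simp_all flip: le_depth_iff_near)
    then have "near ?n a c" by (rule near_trans)
    then show ?thesis
      using False nz by (metis le_depth_iff_near gr0I)
  qed
  then have "inverse \<kappa> ^ depth a c \<le> inverse \<kappa> ^ ?n"
    using inverse_power_le_iff[OF assms] by blast
  also have "\<dots> \<le> max (inverse \<kappa> ^ depth a b) (inverse \<kappa> ^ depth b c)"
    by (simp add: min_def)
  finally show ?thesis
    using False by (simp add: depth_dist_def)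
qed

lemma ultrametric_on_depth_dist:
  assumes "1 < \<kappa>"
  shows "ultrametric_on S (depth_dist \<kappa>)"
  unfolding ultrametric_on_def
proof (intro conjI ballI)
  show "Metric_space S (depth_dist \<kappa>)"
  proof
    show nonneg: "0 \<le> depth_dist \<kappa> x y" for x y
      using assms by (simp add: depth_dist_def)
    show "depth_dist \<kappa> x y = depth_dist \<kappa> y x" for x y
      by (simp add: depth_dist_def depth_sym)
    show "depth_dist \<kappa> x y = 0 \<longleftrightarrow> x = y" for x y
      using assms by (simp add: depth_dist_def)
    show "depth_dist \<kappa> x z \<le> depth_dist \<kappa> x y + depth_dist \<kappa> y z" for x y z
      using depth_dist_ultra[OF assms, of x z y] nonneg[of x y] nonneg[of y z] by linarith
  qed
qed (rule depth_dist_ultra[OF assms])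

text \<open>Reflexivity is where stable equivalence of the two components enters: it provides the levels
  above which they coincide.\<close>

lemma near_refl:
  assumes "a \<in> stable_groupoid N M Q"
  shows "near n a a"
proof -
  obtain m where m: "\<forall>i\<ge>m. snd a i = fst a i"
    using assms by (auto simp: stable_groupoid_def stable_set_def)
  then have "cylinder_eq (max n (nat m)) a a"
    by (simp add: cylinder_eq_def)
  then show ?thesis
    unfolding near_def by (meson max.cobounded1)
qed

text \<open>The next two lemmas compare balls with the relations \<open>near n\<close>. The inequality here is strict
  because distance \<open>1 = \<kappa>\<^sup>0\<close> does not imply a coincidence at any level.\<close>

lemma near_if_depth_dist_less:
  assumes "1 < \<kappa>" "a \<in> stable_groupoid N M Q" "depth_dist \<kappa> a b < inverse \<kappa> ^ n"
  shows "near n a b"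
proof (cases "a = b")
  case True
  then show ?thesis using near_refl assms(2) by blast
next
  case False
  then have "n < depth a b"
    using assms inverse_power_le_iff[OF assms(1)] by (simp add: depth_dist_def not_le[symmetric])
  then have "near (depth a b) a b"
    using False le_depth_iff_near by (metis bot_nat_0.not_eq_extremum not_less_zero order_refl)
  with \<open>n < depth a b\<close> show ?thesis
    using near_mono by (meson less_imp_le)
qed

lemma depth_dist_le_if_near:
  assumes "1 < \<kappa>" "near n a b"
  shows "depth_dist \<kappa> a b \<le> inverse \<kappa> ^ n"
proof (cases "a = b \<or> n = 0")
  case True
  then show ?thesis
    using assms(1) by (auto simp: depth_dist_def power_le_one inverse_le_1_iff)
next
  case False
  then show ?thesis
    using assms le_depth_iff_near inverse_power_le_iff by (simp add: depth_dist_def)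
qed


section \<open>Compatibility with the topology\<close>

text \<open>A basic set of level \<open>n\<close> that contains \<open>x\<close> consists of all groupoid elements \<open>b\<close> with
  \<open>near n x b\<close>. Conversely, every sufficiently high level occurs among the basic sets around \<open>x\<close>.\<close>

lemma openin_stable_topology_iff_near:
  "openin (stable_topology N M Q) U \<longleftrightarrow>
     U \<subseteq> stable_groupoid N M Q \<and>
     (\<forall>x\<in>U. \<exists>n. \<forall>b\<in>stable_groupoid N M Q. near n x b \<longrightarrow> b \<in> U)"
  (is "?L \<longleftrightarrow> ?R")
proof
  assume L: ?L
  then have U: "\<exists>B\<in>stable_base N M Q. x \<in> B \<and> B \<subseteq> U" if "x \<in> U" for x
    using that unfolding openin_stable_topology arbitrary_union_of_alt by blast
  have "\<exists>n. \<forall>b\<in>stable_groupoid N M Q. near n x b \<longrightarrow> b \<in> U" if "x \<in> U" for x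
  proof -
    obtain a n where B: "x \<in> stable_basic N M Q a n" "stable_basic N M Q a n \<subseteq> U"
      using U[OF \<open>x \<in> U\<close>] by (auto simp: stable_base_def)
    have "b \<in> stable_basic N M Q a n"
      if b: "b \<in> stable_groupoid N M Q" and nb: "near n x b" for b
    proof -
      obtain m where m: "n \<le> m" "cylinder_eq m x b"
        using nb by (auto simp: near_def)
      have x: "fst x i = fst a i \<and> snd x i = snd a i" if "i \<le> int n" for i
        using B(1) that by (simp add: stable_basic_def)
      have x': "fst x i = snd x i" if "i > int n" for i
        using B(1) that by (simp add: stable_basic_def)
      have xb: "fst x i = fst b i \<and> snd x i = snd b i" if "i \<le> int m" for i
        using m(2) that by (simp add: cylinder_eq_def)
      have xb': "fst b i = snd b i" if "i > int m" for i
        using m(2) that by (simp add: cylinder_eq_def)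
      have "fst b i = snd b i" if "i > int n" for i
        using x'[OF that] xb[of i] xb'[of i] by (cases "i \<le> int m") simp_all
      moreover have "fst b i = fst a i \<and> snd b i = snd a i" if "i \<le> int n" for i
        using x[OF that] xb[of i] that m(1) by simp
      ultimately show ?thesis
        using b by (simp add: stable_basic_def)
    qed
    with B(2) show ?thesis
      by (intro exI[of _ n]) auto
  qed
  moreover have "U \<subseteq> stable_groupoid N M Q"
    using openin_subset[OF L] by simp
  ultimately show ?R by blast
next
  assume R: ?R
  have "\<exists>B\<in>stable_base N M Q. x \<in> B \<and> B \<subseteq> U" if "x \<in> U" for x
  proof -
    obtain n where n: "\<forall>b\<in>stable_groupoid N M Q. near n x b \<longrightarrow> b \<in> U"
      using R \<open>x \<in> U\<close> by blast
    have x: "x \<in> stable_groupoid N M Q"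
      using R \<open>x \<in> U\<close> by blast
    then obtain k where k: "\<forall>i\<ge>k. snd x i = fst x i"
      by (auto simp: stable_groupoid_def stable_set_def)
    define m where "m = max n (nat k)"
    have tail: "\<forall>i\<ge>int m. fst x i = snd x i"
      using k by (simp add: m_def)
    have "near n x b" if "b \<in> stable_basic N M Q x m" for b
    proof -
      have "cylinder_eq m x b"
        using that tail by (simp add: cylinder_eq_def stable_basic_def)
      moreover have "n \<le> m" by (simp add: m_def)
      ultimately show ?thesis
        unfolding near_def by blast
    qed
    then have "stable_basic N M Q x m \<subseteq> U"
      using n by (auto simp: stable_basic_def)
    with stable_baseI[OF x tail] show ?thesis by blast
  qed
  then show ?L
    unfolding openin_stable_topology arbitrary_union_of_alt by blast
qed

lemma compatible_ultrametric_depth_dist: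
  assumes "1 < \<kappa>"
  shows "compatible_ultrametric (stable_topology N M Q) (depth_dist \<kappa>)"
proof -
  let ?G = "stable_groupoid N M Q"
  have ultra: "ultrametric_on ?G (depth_dist \<kappa>)"
    by (rule ultrametric_on_depth_dist[OF assms])
  then interpret Metric_space ?G "depth_dist \<kappa>"
    by (simp add: ultrametric_on_def)
  have "openin mtopology U \<longleftrightarrow> openin (stable_topology N M Q) U" for U
  proof -
    have "(\<exists>r>0. mball x r \<subseteq> U) \<longleftrightarrow> (\<exists>n. \<forall>b\<in>?G. near n x b \<longrightarrow> b \<in> U)"
      if x: "x \<in> ?G" for x
    proof
      assume "\<exists>r>0. mball x r \<subseteq> U"
      then obtain r where r: "r > 0" "mball x r \<subseteq> U" by blast
      obtain n where n: "inverse \<kappa> ^ n < r"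
        using real_arch_pow_inv[OF r(1)] assms by (metis inverse_less_1_iff)
      have "b \<in> U" if "b \<in> ?G" "near n x b" for b
        using that r(2) x n depth_dist_le_if_near[OF assms that(2)] by (auto simp: in_mball)
      then show "\<exists>n. \<forall>b\<in>?G. near n x b \<longrightarrow> b \<in> U" by blast
    next
      assume "\<exists>n. \<forall>b\<in>?G. near n x b \<longrightarrow> b \<in> U"
      then obtain n where n: "\<forall>b\<in>?G. near n x b \<longrightarrow> b \<in> U" by blast
      have "mball x (inverse \<kappa> ^ n) \<subseteq> U"
        using n x near_if_depth_dist_less[OF assms x] in_mball by blast
      moreover have "inverse \<kappa> ^ n > 0" using assms by simp
      ultimately show "\<exists>r>0. mball x r \<subseteq> U" by blast
    qed
    then show ?thesis
      unfolding openin_mtopology openin_stable_topology_iff_near by blast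
  qed
  then have "mtopology = stable_topology N M Q"
    by (simp add: topology_eq)
  with ultra show ?thesis
    by (simp add: compatible_ultrametric_def)
qed


section \<open>The automorphism\<close>

lemma all_int_shift: "(\<forall>i::int. P (i + 1)) \<longleftrightarrow> (\<forall>i. P i)"
proof (intro iffI allI)
  show "P i" if "\<forall>i. P (i + 1)" for i
    using spec[OF that, of "i - 1"] by simp
qed simp

lemma ex_int_shift: "(\<exists>i::int. P (i + 1)) \<longleftrightarrow> (\<exists>i. P i)"
  using all_int_shift[of "\<lambda>i. \<not> P i"] by blast

lemma bij_shift: "bij shift"
proof (rule o_bij)
  show "(\<lambda>x i. x (i - 1)) \<circ> shift = id" "shift \<circ> (\<lambda>x i. x (i - 1)) = id"
    by (auto simp: shift_def fun_eq_iff)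
qed

lemma inj_Phi: "inj Phi"
  using bij_shift by (simp add: Phi_def bij_is_inj prod.inj_map)

lemma shift_in_chain_space: "shift x \<in> chain_space N M \<longleftrightarrow> x \<in> chain_space N M"
  using all_int_shift[of "\<lambda>i. x i \<in> {1..N}"] all_int_shift[of "\<lambda>i. M (x i) (x (i + 1)) = 1"]
  by (simp add: chain_space_def shift_def)

text \<open>Going round the cycle once provides the predecessor of the base point.\<close>

lemma periodic_orbit_shift_image:
  assumes "periodic_orbit N M Q"
  shows "shift ` Q = Q"
proof -
  obtain p k where k: "k > 0" "(shift ^^ k) p = p" and Q: "Q = range (\<lambda>n. (shift ^^ n) p)"
    using assms by (auto simp: periodic_orbit_def)
  have mem: "(shift ^^ n) p \<in> Q" for n
    unfolding Q by (rule rangeI)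
  have "(shift ^^ n) p \<in> shift ` Q" if "n > 0" for n
    using that imageI[OF mem[of "n - 1"], of shift] by (cases n) simp_all
  moreover from this[OF k(1)] have "(shift ^^ 0) p \<in> shift ` Q"
    using k(2) by simp
  ultimately have "(shift ^^ n) p \<in> shift ` Q" for n
    by (cases "n = 0") simp_all
  then have "Q \<subseteq> shift ` Q"
    by (subst (1) Q) blast
  moreover have "shift ((shift ^^ n) p) \<in> Q" for n
    using mem[of "Suc n"] by simp
  then have "shift ` Q \<subseteq> Q"
    by (subst (1) Q) blast
  ultimately show ?thesis by blast
qed

lemma shift_in_unstable_set: "shift y \<in> unstable_set N M (shift q) \<longleftrightarrow> y \<in> unstable_set N M q"
proof -
  have "(\<forall>i\<le>m. y (i + 1) = q (i + 1)) \<longleftrightarrow> (\<forall>i\<le>m + 1. y i = q i)" for m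
    using all_int_shift[of "\<lambda>i. i \<le> m + 1 \<longrightarrow> y i = q i"] by simp
  then have "(\<exists>m. \<forall>i\<le>m. y (i + 1) = q (i + 1)) \<longleftrightarrow> (\<exists>m. \<forall>i\<le>m. y i = q i)"
    using ex_int_shift[of "\<lambda>m. \<forall>i\<le>m. y i = q i"] by simp
  then show ?thesis
    by (simp add: unstable_set_def shift_in_chain_space) (simp add: shift_def)
qed

lemma shift_in_stable_set: "shift y \<in> stable_set N M (shift x) \<longleftrightarrow> y \<in> stable_set N M x"
proof -
  have "(\<forall>i\<ge>m. y (i + 1) = x (i + 1)) \<longleftrightarrow> (\<forall>i\<ge>m + 1. y i = x i)" for m
    using all_int_shift[of "\<lambda>i. i \<ge> m + 1 \<longrightarrow> y i = x i"] by simp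
  then have "(\<exists>m. \<forall>i\<ge>m. y (i + 1) = x (i + 1)) \<longleftrightarrow> (\<exists>m. \<forall>i\<ge>m. y i = x i)"
    using ex_int_shift[of "\<lambda>m. \<forall>i\<ge>m. y i = x i"] by simp
  then show ?thesis
    by (simp add: stable_set_def shift_in_chain_space) (simp add: shift_def)
qed

lemma Phi_in_stable_groupoid:
  assumes "periodic_orbit N M Q"
  shows "Phi a \<in> stable_groupoid N M Q \<longleftrightarrow> a \<in> stable_groupoid N M Q"
proof -
  have "shift y \<in> unstable_sets N M Q \<longleftrightarrow> y \<in> unstable_sets N M Q" for y
  proof -
    have "shift y \<in> unstable_sets N M Q \<longleftrightarrow> (\<exists>q\<in>shift ` Q. shift y \<in> unstable_set N M q)"
      by (simp add: unstable_sets_def periodic_orbit_shift_image[OF assms])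
    then show ?thesis
      by (simp add: unstable_sets_def shift_in_unstable_set)
  qed
  then show ?thesis
    by (cases a) (simp add: Phi_def stable_groupoid_def shift_in_stable_set)
qed

lemma bij_betw_Phi:
  assumes "periodic_orbit N M Q"
  shows "bij_betw Phi (stable_groupoid N M Q) (stable_groupoid N M Q)"
proof -
  have "surj Phi"
    unfolding Phi_def using bij_shift by (intro map_prod_surj bij_is_surj)
  moreover have "Phi -` stable_groupoid N M Q = stable_groupoid N M Q"
    using Phi_in_stable_groupoid[OF assms] by blast
  ultimately have "Phi ` stable_groupoid N M Q = stable_groupoid N M Q"
    by (metis surj_image_vimage_eq)
  then show ?thesis
    using inj_on_subset[OF inj_Phi] by (simp add: bij_betw_def)
qed

lemma cylinder_eq_Phi: "cylinder_eq n (Phi a) (Phi b) \<longleftrightarrow> cylinder_eq (Suc n) a b"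
proof -
  have le: "(\<forall>i\<le>int n. P (i + 1)) \<longleftrightarrow> (\<forall>i\<le>int (Suc n). P i)" for P
    using all_int_shift[of "\<lambda>i. i \<le> int (Suc n) \<longrightarrow> P i"] by simp
  have gt: "(\<forall>i>int n. P (i + 1)) \<longleftrightarrow> (\<forall>i>int (Suc n). P i)" for P
    using all_int_shift[of "\<lambda>i. i > int (Suc n) \<longrightarrow> P i"]
    by (simp add: add1_zle_eq add.commute[of 1])
  show ?thesis
    using le[of "\<lambda>i. fst a i = fst b i \<and> snd a i = snd b i"]
      gt[of "\<lambda>i. fst a i = snd a i \<and> fst b i = snd b i"]
    by (simp add: cylinder_eq_def Phi_def shift_def)
qed

lemma near_Phi: "near n (Phi a) (Phi b) \<longleftrightarrow> near (Suc n) a b"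
  unfolding near_def cylinder_eq_Phi by (metis Suc_le_D Suc_le_mono)

lemma depth_Phi:
  assumes "a \<noteq> b"
  shows "depth (Phi a) (Phi b) = depth a b - 1"
proof -
  have ne: "Phi a \<noteq> Phi b"
    using assms by (simp add: inj_eq[OF inj_Phi])
  have "n \<le> depth (Phi a) (Phi b) \<longleftrightarrow> n \<le> depth a b - 1" for n
    using le_depth_iff_near[OF ne, of n] le_depth_iff_near[OF assms, of "Suc n"] near_Phi
    by (cases "n = 0") auto
  then show ?thesis
    by (meson le_antisym order_refl)
qed

text \<open>Both directions of continuity come from the shift of levels by one.\<close>

lemma groupoid_automorphism_Phi:
  assumes "periodic_orbit N M Q"
  shows "groupoid_automorphism (stable_topology N M Q) Phi"
proof -
  let ?G = "stable_groupoid N M Q" and ?T = "stable_topology N M Q"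
  note bij = bij_betw_Phi[OF assms] and mem = Phi_in_stable_groupoid[OF assms]
  have "homeomorphic_map ?T ?T Phi"
    unfolding homeomorphic_eq_everything_map
  proof (intro conjI)
    show "continuous_map ?T ?T Phi"
      unfolding continuous_map_def
    proof (intro conjI allI impI)
      show "Phi \<in> topspace ?T \<rightarrow> topspace ?T"
        using mem by simp
      fix U assume U: "openin ?T U"
      have "\<exists>n. \<forall>b\<in>?G. near n x b \<longrightarrow> Phi b \<in> U" if x: "x \<in> ?G" "Phi x \<in> U" for x
      proof -
        obtain n where "\<forall>b\<in>?G. near n (Phi x) b \<longrightarrow> b \<in> U"
          using U x(2) unfolding openin_stable_topology_iff_near by blast
        then have "\<forall>b\<in>?G. near (Suc n) x b \<longrightarrow> Phi b \<in> U"
          using mem near_Phi by blast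
        then show ?thesis by blast
      qed
      then show "openin ?T {x \<in> topspace ?T. Phi x \<in> U}"
        unfolding openin_stable_topology_iff_near by auto
    qed
    show "open_map ?T ?T Phi"
      unfolding open_map_def
    proof (intro allI impI)
      fix U assume U: "openin ?T U"
      then have sub: "U \<subseteq> ?G"
        unfolding openin_stable_topology_iff_near by blast
      have "\<exists>n. \<forall>b\<in>?G. near n (Phi x) b \<longrightarrow> b \<in> Phi ` U" if x: "x \<in> U" for x
      proof -
        obtain n where n: "\<forall>b\<in>?G. near n x b \<longrightarrow> b \<in> U"
          using U x unfolding openin_stable_topology_iff_near by blast
        have "b \<in> Phi ` U" if b: "b \<in> ?G" "near n (Phi x) b" for b
        proof -
          obtain c where c: "c \<in> ?G" "b = Phi c"
            using bij b(1) by (metis bij_betw_imp_surj_on imageE)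
          then have "near (Suc n) x c"
            using b(2) near_Phi by simp
          then have "near n x c"
            by (rule near_mono) simp
          with n c show ?thesis by blast
        qed
        then show ?thesis by blast
      qed
      then show "openin ?T (Phi ` U)"
        unfolding openin_stable_topology_iff_near using sub mem by auto
    qed
    then show "closed_map ?T ?T Phi"
      using bij by (simp add: bijective_open_imp_closed_map bij_betw_def)
    show "Phi ` topspace ?T = topspace ?T" "inj_on Phi (topspace ?T)"
      using bij by (simp_all add: bij_betw_def)
  qed
  then show ?thesis
    by (simp add: groupoid_automorphism_def Phi_def)
qed

text \<open>If \<open>depth a b = 0\<close>, the depth cannot drop any further and \<open>\<Phi>\<close> preserves the distance;
  otherwise \<open>\<Phi>\<close> multiplies it by \<open>\<kappa>\<close>. Distance at most \<open>\<kappa>\<^sup>-\<^sup>1\<close> of the images leaves only the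
  second case.\<close>

lemma depth_dist_Phi:
  assumes "1 < \<kappa>"
  shows "inverse \<kappa> * depth_dist \<kappa> (Phi a) (Phi b) \<le> depth_dist \<kappa> a b"
    and "depth_dist \<kappa> a b \<le> depth_dist \<kappa> (Phi a) (Phi b)"
    and "depth_dist \<kappa> (Phi a) (Phi b) \<le> inverse \<kappa> \<Longrightarrow>
      depth_dist \<kappa> a b = inverse \<kappa> * depth_dist \<kappa> (Phi a) (Phi b)"
proof -
  have inv: "inverse \<kappa> < 1" "0 < inverse \<kappa>"
    using assms by (simp_all add: inverse_less_1_iff)
  have *: "inverse \<kappa> * depth_dist \<kappa> (Phi a) (Phi b) \<le> depth_dist \<kappa> a b \<and>
      depth_dist \<kappa> a b \<le> depth_dist \<kappa> (Phi a) (Phi b) \<and>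
      (depth_dist \<kappa> (Phi a) (Phi b) \<le> inverse \<kappa> \<longrightarrow>
        depth_dist \<kappa> a b = inverse \<kappa> * depth_dist \<kappa> (Phi a) (Phi b))"
  proof (cases "a = b")
    case True
    then show ?thesis by (simp add: depth_dist_def)
  next
    case False
    then have D: "depth_dist \<kappa> a b = inverse \<kappa> ^ depth a b"
      "depth_dist \<kappa> (Phi a) (Phi b) = inverse \<kappa> ^ (depth a b - 1)"
      by (simp_all add: depth_dist_def depth_Phi inj_eq[OF inj_Phi])
    show ?thesis
    proof (cases "depth a b")
      case 0
      with D inv show ?thesis by simp
    next
      case (Suc d)
      have "inverse \<kappa> * inverse \<kappa> ^ d \<le> inverse \<kappa> ^ d"
        using inv by (simp add: mult_left_le_one_le)
      with D Suc show ?thesis by simp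
    qed
  qed
  then show "inverse \<kappa> * depth_dist \<kappa> (Phi a) (Phi b) \<le> depth_dist \<kappa> a b"
    and "depth_dist \<kappa> a b \<le> depth_dist \<kappa> (Phi a) (Phi b)"
    and "depth_dist \<kappa> (Phi a) (Phi b) \<le> inverse \<kappa> \<Longrightarrow>
      depth_dist \<kappa> a b = inverse \<kappa> * depth_dist \<kappa> (Phi a) (Phi b)"
    by blast+
qed


section \<open>Range and source\<close>

lemma depth_dist_swap: "depth_dist \<kappa> (prod.swap a) (prod.swap b) = depth_dist \<kappa> a b"
  unfolding depth_dist_def depth_swap by (auto simp: prod_eq_iff)

text \<open>Levels of coincidence of \<open>(fst b, fst b)\<close> and \<open>(fst c, fst c)\<close> below \<open>n\<close> need not be levels of
  coincidence of \<open>b\<close> and \<open>c\<close>, but they can be raised to \<open>n\<close> and do not change the depth.\<close>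

lemma unit_metric_fst:
  assumes n: "cylinder_eq n b c"
  shows "unit_metric (depth_dist \<kappa>) (fst b) (fst c) = depth_dist \<kappa> b c"
proof -
  have eq: "(fst b, fst b) = (fst c, fst c) \<longleftrightarrow> b = c"
  proof
    assume fst: "(fst b, fst b) = (fst c, fst c)"
    have "snd b i = snd c i" for i
      using n fst unfolding cylinder_eq_def by (cases "i \<le> int n") (force, metis linorder_not_le prod.inject)
    with fst show "b = c"
      by (auto simp: prod_eq_iff)
  qed simp
  have "near j (fst b, fst b) (fst c, fst c) \<longleftrightarrow> near j b c" for j
  proof
    assume "near j (fst b, fst b) (fst c, fst c)"
    then obtain m where m: "j \<le> m" "cylinder_eq m (fst b, fst b) (fst c, fst c)"
      by (auto simp: near_def)
    have "snd b i = snd c i" if "i \<le> int m" for i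
      using n m(2) that unfolding cylinder_eq_def by (cases "i \<le> int n") auto
    then have "cylinder_eq (max m n) b c"
      using n m(2) unfolding cylinder_eq_def by (auto simp: max_def)
    with m(1) show "near j b c"
      unfolding near_def by (meson max.coboundedI1)
  next
    assume "near j b c"
    then show "near j (fst b, fst b) (fst c, fst c)"
      by (auto simp: near_def cylinder_eq_def)
  qed
  then have "depth (fst b, fst b) (fst c, fst c) = depth b c" if "b \<noteq> c"
    using that eq by (intro depth_eqI) simp_all
  with eq show ?thesis
    unfolding unit_metric_def depth_dist_def by (cases "b = c") simp_all
qed

lemma unit_metric_snd:
  assumes "cylinder_eq n b c"
  shows "unit_metric (depth_dist \<kappa>) (snd b) (snd c) = depth_dist \<kappa> b c"
  using unit_metric_fst[of n "prod.swap b" "prod.swap c" \<kappa>] assms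
  by (simp add: cylinder_eq_swap depth_dist_swap)

lemma locally_isometric_range_source:
  "locally_isometric (stable_topology N M Q) (depth_dist \<kappa>) (unit_metric (depth_dist \<kappa>)) fst"
  "locally_isometric (stable_topology N M Q) (depth_dist \<kappa>) (unit_metric (depth_dist \<kappa>)) snd"
proof -
  have "\<exists>U. openin (stable_topology N M Q) U \<and> a \<in> U \<and>
      (\<forall>b\<in>U. \<forall>c\<in>U. \<exists>n. cylinder_eq n b c)"
    if a: "a \<in> stable_groupoid N M Q" for a
  proof -
    obtain B where B: "B \<in> stable_base N M Q" "a \<in> B"
      using a Union_stable_base by blast
    then have "openin (stable_topology N M Q) B"
      by (simp add: stable_topology_def topology_generated_by_Basis)
    moreover have "\<exists>n. cylinder_eq n b c" if "b \<in> B" "c \<in> B" for b c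
    proof -
      obtain e n where "B = stable_basic N M Q e n"
        using B(1) by (auto simp: stable_base_def)
      with that have "cylinder_eq n b c"
        by (simp add: stable_basic_def cylinder_eq_def)
      then show ?thesis ..
    qed
    ultimately show ?thesis
      using B(2) by blast
  qed
  then show
    "locally_isometric (stable_topology N M Q) (depth_dist \<kappa>) (unit_metric (depth_dist \<kappa>)) fst"
    "locally_isometric (stable_topology N M Q) (depth_dist \<kappa>) (unit_metric (depth_dist \<kappa>)) snd"
    unfolding locally_isometric_def topspace_stable_topology
    using unit_metric_fst unit_metric_snd by meson+
qed

lemma range_source_stable_groupoid:
  "fst ` stable_groupoid N M Q = unstable_sets N M Q"
  "snd ` stable_groupoid N M Q = unstable_sets N M Q"
proof -
  have "(x, x) \<in> stable_groupoid N M Q" if "x \<in> unstable_sets N M Q" for x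
    using that
    by (auto simp: stable_groupoid_def unstable_sets_def unstable_set_def stable_set_def)
  then show "fst ` stable_groupoid N M Q = unstable_sets N M Q"
    "snd ` stable_groupoid N M Q = unstable_sets N M Q"
    by (force simp: stable_groupoid_def)+
qed

theorem proposition6p20:
  fixes N :: nat and M :: "nat \<Rightarrow> nat \<Rightarrow> nat" and Q :: "(int \<Rightarrow> nat) set"
  assumes "zero_one_matrix N M"
    and "infinite (chain_space N M)"
    and "irreducible_chain N M"
    and "periodic_orbit N M Q"
  defines "G \<equiv> stable_groupoid N M Q"
    and "T \<equiv> stable_topology N M Q"
  defines "Phi_inv \<equiv> inv_into G Phi"
  shows "groupoid_automorphism T Phi \<and>
    (\<exists>D :: real \<Rightarrow> (int \<Rightarrow> nat) \<times> (int \<Rightarrow> nat) \<Rightarrow> (int \<Rightarrow> nat) \<times> (int \<Rightarrow> nat) \<Rightarrow> real.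
      \<forall>\<kappa>>1.
        compatible_ultrametric T (D \<kappa>) \<and>
        (\<forall>a\<in>G. \<forall>b\<in>G.
           inverse \<kappa> * D \<kappa> a b \<le> D \<kappa> (Phi_inv a) (Phi_inv b) \<and>
           D \<kappa> (Phi_inv a) (Phi_inv b) \<le> D \<kappa> a b) \<and>
        (\<forall>a\<in>G. \<forall>b\<in>G. D \<kappa> a b \<le> inverse \<kappa> \<longrightarrow>
           D \<kappa> (Phi_inv a) (Phi_inv b) = inverse \<kappa> * D \<kappa> a b) \<and>
        fst ` G = unstable_sets N M Q \<and>
        snd ` G = unstable_sets N M Q \<and>
        locally_isometric T (D \<kappa>) (unit_metric (D \<kappa>)) fst \<and>
        locally_isometric T (D \<kappa>) (unit_metric (D \<kappa>)) snd \<and>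
        (\<forall>a\<in>G. \<forall>b\<in>G. D \<kappa> (prod.swap a) (prod.swap b) = D \<kappa> a b))"
proof -
  note Q = \<open>periodic_orbit N M Q\<close>
  have Phi_inv: "Phi (Phi_inv a) = a" if "a \<in> G" for a
    using bij_betw_Phi[OF Q] that unfolding G_def Phi_inv_def
    by (simp add: bij_betw_inv_into_right)
  show ?thesis
  proof (intro conjI exI[of _ depth_dist] allI impI ballI)
    show "groupoid_automorphism T Phi"
      unfolding T_def by (rule groupoid_automorphism_Phi[OF Q])
    show "fst ` G = unstable_sets N M Q" "snd ` G = unstable_sets N M Q"
      unfolding G_def by (rule range_source_stable_groupoid)+
    fix \<kappa> :: real assume \<kappa>: "1 < \<kappa>"
    show "compatible_ultrametric T (depth_dist \<kappa>)"
      unfolding T_def by (rule compatible_ultrametric_depth_dist[OF \<kappa>])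
    show "locally_isometric T (depth_dist \<kappa>) (unit_metric (depth_dist \<kappa>)) fst"
      "locally_isometric T (depth_dist \<kappa>) (unit_metric (depth_dist \<kappa>)) snd"
      unfolding T_def by (rule locally_isometric_range_source)+
    fix a b assume ab: "a \<in> G" "b \<in> G"
    note Phi_dist =
      depth_dist_Phi[OF \<kappa>, of "Phi_inv a" "Phi_inv b", unfolded Phi_inv[OF ab(1)] Phi_inv[OF ab(2)]]
    show "inverse \<kappa> * depth_dist \<kappa> a b \<le> depth_dist \<kappa> (Phi_inv a) (Phi_inv b)"
      "depth_dist \<kappa> (Phi_inv a) (Phi_inv b) \<le> depth_dist \<kappa> a b"
      by (rule Phi_dist)+
    show "depth_dist \<kappa> (Phi_inv a) (Phi_inv b) = inverse \<kappa> * depth_dist \<kappa> a b"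
      if "depth_dist \<kappa> a b \<le> inverse \<kappa>"
      using that by (rule Phi_dist)
    show "depth_dist \<kappa> (prod.swap a) (prod.swap b) = depth_dist \<kappa> a b"
      by (rule depth_dist_swap)
  qed
qed

end
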